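(* Let $k\in\mathbb{N}$ (with $k\ge1$), let $G=(V,E)$ be a finite weighted graph with vertex measure $\mu:V\to(0,\infty)$, and let $s:E^{or}\to S_k^1$ be a signature of $G$. For any nonzero function $f:V\to\mathbb{C}$ with $\max_{u\in V}|f(u)|=1$, there exist $t'\in[0,1]$ and $\theta'\in[0,2\pi)$ such that $$\beta_\mu^s\big(\mathscr V_k(V^f(\sqrt{t'},\theta'))\big)\;\le\;2\sqrt{2\,d_\mu\,\mathcal R_\mu^s(f)} ,$$ where $\mathscr V_k(V^f(\sqrt t,\theta))$ denotes the ordered $k$-partition $V_0^f(\sqrt t,\theta),\dots,V_{k-1}^f(\sqrt t,\theta)$ of $V^f(\sqrt t,\theta):=\bigcup_{j=0}^{k-1}V_j^f(\sqrt t,\theta)$ given by $$V_j^f(\sqrt t,\theta)=\{u\in V\mid\sqrt t\le|f(u)|\ \text{and}\ f(u)\in Q_j^\theta\},\qquad 0\le j\le k-1 .$$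
   Context: $G=(V,E)$ is a finite simple undirected graph; every edge $\{u,v\}\in E$ carries a positive symmetric weight $w_{uv}=w_{vu}$; $u\sim v$ means $\{u,v\}\in E$; $d_u=\sum_{v\sim u}w_{uv}$ and $d_\mu=\max_{u\in V}d_u/\mu(u)$. $E^{or}=\{(u,v),(v,u)\mid \{u,v\}\in E\}$. $S_k^1=\{\xi^j\mid1\le j\le k\}$ with $\xi=e^{2\pi i/k}$. A signature is a map $s:E^{or}\to S_k^1$, $s_{uv}:=s((u,v))$, with $s_{vu}=s_{uv}^{-1}$. The Rayleigh quotient of $f\not\equiv0$ is $\mathcal R_\mu^s(f)=\frac{\sum_{\{u,v\}\in E}w_{uv}|f(u)-s_{uv}f(v)|^2}{\sum_{u\in V}|f(u)|^2\mu(u)}$. Sectors: $Q_j^\theta=\{re^{i\alpha}\mid r\in(0,1],\ \alpha\in[\theta+\frac{2\pi j}k,\theta+\frac{2\pi(j+1)}k)\}$ for $\theta\in[0,2\pi)$, $j=0,\dots,k-1$. An ordered $k$-partition $\mathscr V_k(\widetilde V)$ of a nonempty $\widetilde V\subseteq V$ is a sequence $\widetilde V_0,\dots,\widetilde V_{k-1}$ of pairwise disjoint (possibly empty) sets with union $\widetilde V$. For $l\in\mathbb{Z}$ put $|E^l(\widetilde V_i,\widetilde V_j)|=\sum_{u\in\widetilde V_i}\sum_{v\in\widetilde V_j,\,v\sim u,\,s_{uv}=\xi^l}w_{uv}$. Let $|E(\widetilde V,\widetilde V^c)|=\sum_{u\in\widetilde V}\sum_{v\in V\setminus\widetilde V,\,v\sim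 u}w_{uv}$ and $\mathrm{vol}_\mu(\widetilde V)=\sum_{u\in\widetilde V}\mu(u)$. The $k$-partiteness ratio is $$\beta_\mu^s(\mathscr V_k(\widetilde V))=\frac{\frac12\sum_{i,j=0}^{k-1}\sum_{l=1}^{k-1}|1-\xi^l|\cdot|E^{i-j+l}(\widetilde V_i,\widetilde V_j)|+|E(\widetilde V,\widetilde V^c)|}{\mathrm{vol}_\mu(\widetilde V)}.$$ *)

theory Defs
  imports "HOL-Analysis.Analysis"
begin

section \<open>Finite weighted graphs\<close>

locale weighted_graph =
  fixes V :: "'a set" and E :: "'a set set" and w :: "'a \<Rightarrow> 'a \<Rightarrow> real"
  assumes finite_V: "finite V"
    and edge_subset: "e \<in> E \<Longrightarrow> e \<subseteq> V"
    and edge_card: "e \<in> E \<Longrightarrow> card e = 2"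
    and weight_pos: "{u, v} \<in> E \<Longrightarrow> w u v > 0"
    and weight_sym: "{u, v} \<in> E \<Longrightarrow> w u v = w v u"

definition oriented_edges :: "'a set set \<Rightarrow> ('a \<times> 'a) set" where
  "oriented_edges E = {(u, v). {u, v} \<in> E}"

definition degree :: "'a set \<Rightarrow> 'a set set \<Rightarrow> ('a \<Rightarrow> 'a \<Rightarrow> real) \<Rightarrow> 'a \<Rightarrow> real" where
  "degree V E w u = (\<Sum>v\<in>{v \<in> V. {u, v} \<in> E}. w u v)"

definition max_degree ::
    "'a set \<Rightarrow> 'a set set \<Rightarrow> ('a \<Rightarrow> 'a \<Rightarrow> real) \<Rightarrow> ('a \<Rightarrow> real) \<Rightarrow> real" where
  "max_degree V E w \<mu> = Max ((\<lambda>u. degree V E w u / \<mu> u) ` V)"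

definition vol :: "('a \<Rightarrow> real) \<Rightarrow> 'a set \<Rightarrow> real" where
  "vol \<mu> A = (\<Sum>u\<in>A. \<mu> u)"

text \<open>
  Sum over unordered edges of a quantity \<open>g u v\<close> that depends on the edge only, i.e. such that
  \<open>g u v = g v u\<close> for every edge; the description operator picks that common value
  (see \<open>edge_value\<close> and \<open>edge_sum_eq_half\<close>).
\<close>

definition edge_sum :: "'a set set \<Rightarrow> ('a \<Rightarrow> 'a \<Rightarrow> real) \<Rightarrow> real" where
  "edge_sum E g = (\<Sum>e\<in>E. THE x. \<exists>u v. e = {u, v} \<and> x = g u v)"

section \<open>Signatures with values in the roots of unity\<close>

definition xi :: "nat \<Rightarrow> complex" where
  "xi k = exp (2 * complex_of_real pi * \<i> / of_nat k)"

definition cyclic_group :: "nat \<Rightarrow> complex set" where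
  "cyclic_group k = {xi k ^ j | j. 1 \<le> j \<and> j \<le> k}"

definition signature :: "nat \<Rightarrow> 'a set set \<Rightarrow> ('a \<Rightarrow> 'a \<Rightarrow> complex) \<Rightarrow> bool" where
  "signature k E s \<longleftrightarrow>
    (\<forall>(u, v)\<in>oriented_edges E. s u v \<in> cyclic_group k \<and> s v u = inverse (s u v))"

definition rayleigh ::
    "'a set \<Rightarrow> 'a set set \<Rightarrow> ('a \<Rightarrow> 'a \<Rightarrow> real) \<Rightarrow> ('a \<Rightarrow> real) \<Rightarrow> ('a \<Rightarrow> 'a \<Rightarrow> complex)
      \<Rightarrow> ('a \<Rightarrow> complex) \<Rightarrow> real" where
  "rayleigh V E w \<mu> s f =
    edge_sum E (\<lambda>u v. w u v * (cmod (f u - s u v * f v))\<^sup>2) / (\<Sum>u\<in>V. (cmod (f u))\<^sup>2 * \<mu> u)"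

section \<open>Ordered partitions and the partiteness ratio\<close>

text \<open>A sequence of \<open>k\<close> sets is a function on \<^typ>\<open>nat\<close> of which only the values below \<open>k\<close> matter.\<close>

definition ordered_partition :: "nat \<Rightarrow> 'a set \<Rightarrow> (nat \<Rightarrow> 'a set) \<Rightarrow> bool" where
  "ordered_partition k A P \<longleftrightarrow>
    A \<noteq> {} \<and> (\<forall>i<k. \<forall>j<k. i \<noteq> j \<longrightarrow> P i \<inter> P j = {}) \<and> (\<Union>j<k. P j) = A"

definition edges_between ::
    "nat \<Rightarrow> 'a set set \<Rightarrow> ('a \<Rightarrow> 'a \<Rightarrow> real) \<Rightarrow> ('a \<Rightarrow> 'a \<Rightarrow> complex) \<Rightarrow> int \<Rightarrow> 'a set \<Rightarrow> 'a set
      \<Rightarrow> real" where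
  "edges_between k E w s l A B = (\<Sum>u\<in>A. \<Sum>v\<in>{v \<in> B. {u, v} \<in> E \<and> s u v = xi k powi l}. w u v)"

definition boundary :: "'a set \<Rightarrow> 'a set set \<Rightarrow> ('a \<Rightarrow> 'a \<Rightarrow> real) \<Rightarrow> 'a set \<Rightarrow> real" where
  "boundary V E w A = (\<Sum>u\<in>A. \<Sum>v\<in>{v \<in> V - A. {u, v} \<in> E}. w u v)"

definition partiteness_ratio ::
    "nat \<Rightarrow> 'a set \<Rightarrow> 'a set set \<Rightarrow> ('a \<Rightarrow> 'a \<Rightarrow> real) \<Rightarrow> ('a \<Rightarrow> real) \<Rightarrow> ('a \<Rightarrow> 'a \<Rightarrow> complex)
      \<Rightarrow> (nat \<Rightarrow> 'a set) \<Rightarrow> real" where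
  "partiteness_ratio k V E w \<mu> s P =
    (1 / 2 * (\<Sum>i<k. \<Sum>j<k. \<Sum>l\<in>{1..<k}.
        cmod (1 - xi k ^ l) * edges_between k E w s (int i - int j + int l) (P i) (P j))
      + boundary V E w (\<Union>j<k. P j)) / vol \<mu> (\<Union>j<k. P j)"

section \<open>The partition induced by a function\<close>

definition sector :: "nat \<Rightarrow> real \<Rightarrow> nat \<Rightarrow> complex set" where
  "sector k \<theta> j = {complex_of_real r * exp (\<i> * complex_of_real \<alpha>) | r \<alpha>.
    r \<in> {0<..1} \<and> \<alpha> \<in> {\<theta> + 2 * pi * real j / real k ..< \<theta> + 2 * pi * (real j + 1) / real k}}"

text \<open>The argument \<open>c\<close> below is the threshold itself, i.e. the square root of \<open>t\<close>.\<close>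

definition level_part ::
    "nat \<Rightarrow> 'a set \<Rightarrow> ('a \<Rightarrow> complex) \<Rightarrow> real \<Rightarrow> real \<Rightarrow> nat \<Rightarrow> 'a set" where
  "level_part k V f c \<theta> j = {u \<in> V. c \<le> cmod (f u) \<and> f u \<in> sector k \<theta> j}"

section \<open>Well-definedness\<close>

lemma edge_value:
  assumes "g u v = g v u"
  shows "(THE x. \<exists>a b. {u, v} = {a, b} \<and> x = g a b) = g u v"
  by (rule the_equality) (use assms in \<open>auto simp: doubleton_eq_iff\<close>)

context weighted_graph
begin

lemma finite_E: "finite E"
  by (rule finite_subset[of _ "Pow V"]) (use edge_subset finite_V in auto)

lemma oriented_edges_eq: "oriented_edges E = (\<Union>e\<in>E. {(u, v). e = {u, v}})"
  by (auto simp: oriented_edges_def)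

lemma edge_sum_eq_half:
  assumes "\<And>u v. {u, v} \<in> E \<Longrightarrow> g u v = g v u"
  shows "edge_sum E g = (\<Sum>(u, v)\<in>oriented_edges E. g u v) / 2"
proof -
  have two: "\<exists>u v. u \<noteq> v \<and> e = {u, v}" if "e \<in> E" for e
    using edge_card[OF that] by (auto simp: card_2_iff)
  have orient: "{(a, b). {u, v} = {a, b}} = {(u, v), (v, u)}" for u v :: 'a
    by (auto simp: doubleton_eq_iff)
  have "(\<Sum>(u, v)\<in>oriented_edges E. g u v) = (\<Sum>e\<in>E. \<Sum>(u, v)\<in>{(u, v). e = {u, v}}. g u v)"
    unfolding oriented_edges_eq
  proof (rule sum.UNION_disjoint)
    show "finite E" by (rule finite_E)
    show "\<forall>e\<in>E. finite {(u, v). e = {u, v}}"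
    proof
      fix e assume "e \<in> E"
      then obtain u v where "e = {u, v}" using two by blast
      then show "finite {(u, v). e = {u, v}}" using orient[of u v] by simp
    qed
  qed auto
  also have "\<dots> = (\<Sum>e\<in>E. 2 * (THE x. \<exists>u v. e = {u, v} \<and> x = g u v))"
  proof (rule sum.cong[OF refl])
    fix e assume e: "e \<in> E"
    then obtain u v where uv: "u \<noteq> v" "e = {u, v}" using two by blast
    have sym: "g u v = g v u" using assms e uv by simp
    show "(\<Sum>(u, v)\<in>{(u, v). e = {u, v}}. g u v) = 2 * (THE x. \<exists>u v. e = {u, v} \<and> x = g u v)"
      unfolding uv(2) orient edge_value[of g, OF sym] using uv(1) sym by simp
  qed
  finally show ?thesis by (simp add: edge_sum_def flip: sum_distrib_left)
qed

end

lemma norm_cyclic_group: "z \<in> cyclic_group k \<Longrightarrow> cmod z = 1"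
  by (auto simp: cyclic_group_def xi_def norm_power)

lemma rayleigh_term_sym:
  assumes "weighted_graph V E w" "signature k E s" "{u, v} \<in> E"
  shows "w u v * (cmod (f u - s u v * f v))\<^sup>2 = w v u * (cmod (f v - s v u * f u))\<^sup>2"
proof -
  have s: "s u v \<in> cyclic_group k" "s v u = inverse (s u v)"
    using assms(2,3) by (auto simp: signature_def oriented_edges_def)
  have n: "cmod (s u v) = 1" using norm_cyclic_group[OF s(1)] .
  then have nz: "s u v \<noteq> 0" by auto
  have "f u - s u v * f v = - s u v * (f v - s v u * f u)"
    using nz by (simp add: s(2) algebra_simps)
  then have "cmod (f u - s u v * f v) = cmod (f v - s v u * f u)"
    using n by (simp add: norm_mult)
  moreover have "w u v = w v u" by (rule weighted_graph.weight_sym[OF assms(1,3)])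
  ultimately show ?thesis by simp
qed

lemma sector_disjoint:
  assumes "i < k" "j < k" "i \<noteq> j"
  shows "sector k \<theta> i \<inter> sector k \<theta> j = {}"
proof -
  have aux: False
    if ij: "i < j" "j < k"
      and z: "complex_of_real r * exp (\<i> * complex_of_real \<alpha>)
        = complex_of_real r' * exp (\<i> * complex_of_real \<alpha>')"
      and r: "r > 0" "r' > 0"
      and a: "\<theta> + 2 * pi * real i / real k \<le> \<alpha>" "\<alpha> < \<theta> + 2 * pi * (real i + 1) / real k"
      and a': "\<theta> + 2 * pi * real j / real k \<le> \<alpha>'" "\<alpha>' < \<theta> + 2 * pi * (real j + 1) / real k"
    for i j :: nat and r r' \<alpha> \<alpha>'
  proof -
    have "r = r'" using arg_cong[OF z, of cmod] r by (simp add: norm_mult)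
    then have "cis \<alpha> = cis \<alpha>'" using z r by (simp add: cis_conv_exp)
    then have "sin \<alpha>' = sin \<alpha> \<and> cos \<alpha>' = cos \<alpha>" by (auto simp: complex_eq_iff)
    then obtain n :: int where n: "\<alpha>' = \<alpha> + 2 * pi * n" using sin_cos_eq_iff by blast
    have k: "real k > 0" using ij by simp
    have le: "2 * pi * (real i + 1) / real k \<le> 2 * pi * real j / real k"
      using ij k by (intro divide_right_mono mult_left_mono) auto
    have "2 * pi * (real j + 1) / real k \<le> 2 * pi * real k / real k"
      using ij k by (intro divide_right_mono mult_left_mono) auto
    then have le': "2 * pi * (real j + 1) / real k \<le> 2 * pi" using k by simp
    have ge: "0 \<le> 2 * pi * real i / real k" by simp
    have "0 < 2 * pi * n" using n a(2) a'(1) le by linarith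
    moreover have "2 * pi * n < 2 * pi * 1" using n a(1) a'(2) le' ge by linarith
    ultimately show False
      by (simp add: zero_less_mult_iff)
  qed
  have lt: "sector k \<theta> i \<inter> sector k \<theta> j = {}" if "i < j" "j < k" for i j
    using aux[OF that] unfolding sector_def by auto
  show ?thesis using lt[of i j] lt[of j i] assms by (auto simp: neq_iff)
qed

lemma sector_cover:
  assumes "k \<ge> 1" "z \<noteq> 0" "cmod z \<le> 1"
  shows "\<exists>j<k. z \<in> sector k \<theta> j"
proof -
  define x where "x = frac ((Arg z - \<theta>) / (2 * pi))"
  define j where "j = nat \<lfloor>real k * x\<rfloor>"
  define \<alpha> where "\<alpha> = \<theta> + 2 * pi * x"
  have x: "0 \<le> x" "x < 1" by (simp_all add: x_def frac_lt_1)
  have k: "real k > 0" using assms by simp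
  have kx: "0 \<le> real k * x" "real k * x < real k" using x k by auto
  have j: "real j \<le> real k * x" "real k * x < real j + 1"
    using kx by (auto simp: j_def)
  then have "j < k" using kx by linarith
  have jk: "real j / real k \<le> x" "x < (real j + 1) / real k"
    using j k by (simp_all add: pos_divide_le_eq pos_less_divide_eq mult.commute)
  have bounds: "2 * pi * real j / real k \<le> 2 * pi * x" "2 * pi * x < 2 * pi * (real j + 1) / real k"
    using mult_left_mono[OF jk(1), of "2 * pi"] mult_strict_left_mono[OF jk(2), of "2 * pi"]
    by simp_all
  have "Arg z = \<alpha> + 2 * pi * \<lfloor>(Arg z - \<theta>) / (2 * pi)\<rfloor>"
    by (simp add: \<alpha>_def x_def frac_def field_simps)
  then have "cis (Arg z) = cis \<alpha> * cis (2 * pi * \<lfloor>(Arg z - \<theta>) / (2 * pi)\<rfloor>)"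
    by (metis cis_mult)
  then have "cis (Arg z) = cis \<alpha>" by simp
  then have "z = complex_of_real (cmod z) * exp (\<i> * complex_of_real \<alpha>)"
    using assms cis_Arg[of z]
    by (simp add: cis_conv_exp[symmetric] sgn_div_norm scaleR_conv_of_real field_simps)
  then have "z \<in> sector k \<theta> j"
    unfolding sector_def using assms bounds \<alpha>_def
    by (intro CollectI exI[of _ "cmod z"] exI[of _ \<alpha>]) auto
  then show ?thesis using \<open>j < k\<close> by blast
qed

lemma level_part_ordered_partition:
  assumes "k \<ge> 1" "finite V" "V \<noteq> {}" "Max ((\<lambda>u. cmod (f u)) ` V) = 1" "c \<le> 1"
  shows "ordered_partition k (\<Union>j<k. level_part k V f c \<theta> j) (level_part k V f c \<theta>)"
proof -
  have "1 \<in> (\<lambda>u. cmod (f u)) ` V" using Max_in[of "(\<lambda>u. cmod (f u)) ` V"] assms by auto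
  then obtain u where u: "u \<in> V" "cmod (f u) = 1" by auto
  then obtain j where "j < k" "f u \<in> sector k \<theta> j"
    using sector_cover[of k "f u" \<theta>] assms(1) by fastforce
  then have "u \<in> (\<Union>j<k. level_part k V f c \<theta> j)"
    using u assms(5) by (auto simp: level_part_def)
  then show ?thesis
    using sector_disjoint[of _ k _ \<theta>] unfolding ordered_partition_def level_part_def by blast
qed

end

theory Submission
  imports Defs
begin

text \<open>
  Choose \<open>t\<close> and \<open>\<theta>\<close> at random and compare expected numerator and expected volume of the
  partition. The set \<open>V\<^sup>f(\<surd>t, \<theta>)\<close> has expected volume \<open>\<Sum>\<^sub>u |f(u)|\<^sup>2 \<mu>(u)\<close>. An oriented edge \<open>(u, v)\<close>
  lies in the boundary with probability \<open>|f(u)|\<^sup>2 - min (|f(u)|\<^sup>2) (|f(v)|\<^sup>2)\<close>. If both ends are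
  selected, they contribute \<open>|\<xi>\<^sup>i - s\<^sub>u\<^sub>v \<xi>\<^sup>j|\<close> where \<open>i\<close>, \<open>j\<close> are the sectors of \<open>f(u)\<close>, \<open>f(v)\<close>; as these
  indices are floors of shifted arguments, the mean over \<open>\<theta>\<close> is at most the angle between \<open>f(u)\<close>
  and \<open>s\<^sub>u\<^sub>v f(v)\<close>. Hence the expected numerator is at most
  \<open>\<Sum> w\<^sub>u\<^sub>v |f(u) - s\<^sub>u\<^sub>v f(v)| (|f(u)| + |f(v)|)\<close> over oriented edges, which the Cauchy-Schwarz
  inequality bounds by the required multiple of the expected volume.
\<close>

section \<open>Integrals over the half-open unit interval\<close>

lemma has_integral_Ico_iff_Icc:
  fixes f :: "real \<Rightarrow> real"
  shows "(f has_integral I) {a..<b} \<longleftrightarrow> (f has_integral I) {a..b}"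
  by (rule has_integral_spike_set_eq) (auto intro: negligible_subset[of "{b}"])

text \<open>First moment method. If \<open>f\<close> exceeded \<open>I\<close> at every point,
  \<open>f - I\<close> would be positive with integral zero, hence zero almost everywhere, and the
  unit interval would be a null set.\<close>

lemma has_integral_unit_ex_le:
  fixes f :: "real \<Rightarrow> real"
  assumes "(f has_integral I) {0..<1}"
  shows "\<exists>x\<in>{0..<1}. f x \<le> I"
proof (rule ccontr)
  assume "\<not> ?thesis"
  then have pos: "f x - I > 0" if "x \<in> {0..<1}" for x
    using that by (metis diff_gt_0_iff_gt not_le)
  have "((\<lambda>x. I) has_integral I) {0..1::real}"
    using has_integral_const_real[of I 0 1] by simp
  then have "((\<lambda>x. I) has_integral I) {0..<1::real}"
    by (simp only: has_integral_Ico_iff_Icc)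
  then have int: "((\<lambda>x. f x - I) has_integral 0) {0..<1}"
    using has_integral_diff[OF assms] by fastforce
  then have abs: "(\<lambda>x. f x - I) absolutely_integrable_on {0..<1}"
    using pos by (intro nonnegative_absolutely_integrable_1) (auto intro: less_imp_le)
  then have "set_lebesgue_integral lebesgue {0..<1} (\<lambda>x. f x - I) = 0"
    using int has_integral_unique[OF has_integral_set_lebesgue[OF abs]] by simp
  moreover have "AE x in lebesgue. 0 \<le> indicat_real {0..<1} x *\<^sub>R (f x - I)"
    using less_imp_le[OF pos] by (intro AE_I2) (simp add: indicator_def)
  ultimately have "AE x in lebesgue. indicat_real {0..<1} x *\<^sub>R (f x - I) = 0"
    using abs integral_nonneg_eq_0_iff_AE
    unfolding set_lebesgue_integral_def set_integrable_def by blast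
  moreover have "x \<notin> {0..<1}" if "indicat_real {0..<1} x *\<^sub>R (f x - I) = 0" for x
    using that pos[of x] by (auto simp: indicator_def)
  ultimately have "AE x in lebesgue. x \<notin> {0..<1::real}"
    by (rule eventually_mono)
  then have "{0..<1::real} \<in> null_sets lebesgue"
    by (subst AE_iff_null_sets) auto
  then have "emeasure lebesgue {0..<1::real} = 0" by auto
  then show False by simp
qed

lemma has_integral_unit_threshold:
  fixes c :: real
  assumes "0 \<le> c" "c \<le> 1"
  shows "((\<lambda>x. of_bool (x \<le> c)) has_integral c) {0..<1}"
proof -
  have "((\<lambda>x. 1) has_integral c) {0..c}"
    using has_integral_const_real[of "1::real" 0 c] assms by simp
  then have "((\<lambda>x. of_bool (x \<le> c)) has_integral c) {0..c}"
    by (rule has_integral_eq[rotated]) simp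
  moreover have "((\<lambda>x. of_bool (x \<le> c)) has_integral (0::real)) {c..1}"
    by (rule has_integral_spike_finite[of "{c}" _ _ "\<lambda>_. 0"]) auto
  ultimately have "((\<lambda>x. of_bool (x \<le> c)) has_integral c + 0) {0..1}"
    using assms by (rule has_integral_combine[rotated 2])
  then show ?thesis by (simp add: has_integral_Ico_iff_Icc)
qed

lemma has_integral_unit_const: "((\<lambda>x. c) has_integral c) {0..<1::real}" for c :: real
  using has_integral_const_real[of c 0 1] by (simp add: has_integral_Ico_iff_Icc)

text \<open>For \<open>x\<close> in the unit interval the floor takes only two values: it equals
  \<open>\<lfloor>A\<rfloor>\<close> up to \<open>x = frac A\<close> and is one less beyond, so its
  mean is \<open>frac A + \<lfloor>A\<rfloor> - 1\<close>.\<close>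

lemma has_integral_unit_floor:
  fixes A :: real
  shows "((\<lambda>x. real_of_int \<lfloor>A - x\<rfloor>) has_integral A - 1) {0..<1}"
proof -
  have "((\<lambda>x. of_bool (x \<le> frac A) + (of_int \<lfloor>A\<rfloor> - 1)) has_integral frac A + (of_int \<lfloor>A\<rfloor> - 1))
      {0..<1::real}"
    by (intro has_integral_add has_integral_unit_threshold has_integral_unit_const)
      (simp_all add: less_imp_le frac_lt_1)
  moreover have "of_bool (x \<le> frac A) + (of_int \<lfloor>A\<rfloor> - 1) = real_of_int \<lfloor>A - x\<rfloor>"
    if "x \<in> {0..<1}" for x
  proof (cases "x \<le> frac A")
    case True
    then have "\<lfloor>A - x\<rfloor> = \<lfloor>A\<rfloor>"
      using that by (auto simp: frac_def floor_eq_iff) linarith+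
    then show ?thesis using True by simp
  next
    case False
    then have "\<lfloor>A - x\<rfloor> = \<lfloor>A\<rfloor> - 1"
      using that by (auto simp: frac_def floor_eq_iff) linarith+
    then show ?thesis using False by simp
  qed
  ultimately have "((\<lambda>x. real_of_int \<lfloor>A - x\<rfloor>) has_integral frac A + (of_int \<lfloor>A\<rfloor> - 1)) {0..<1}"
    by (rule has_integral_eq[rotated])
  then show ?thesis by (simp add: frac_def)
qed

text \<open>Monotonicity of the floor fixes the sign of the difference for all \<open>x\<close>, so
  the absolute value passes through the integral. Rounding with a random shift thus preserves
  distances on average.\<close>

lemma has_integral_unit_floor_diff:
  fixes A B :: real
  shows "((\<lambda>x. \<bar>real_of_int \<lfloor>A - x\<rfloor> - of_int \<lfloor>B - x\<rfloor>\<bar>) has_integral \<bar>A - B\<bar>) {0..<1}"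
proof -
  have *: "((\<lambda>x. \<bar>real_of_int \<lfloor>A - x\<rfloor> - of_int \<lfloor>B - x\<rfloor>\<bar>) has_integral A - B) {0..<1}"
    if "B \<le> A" for A B :: real
  proof -
    have "((\<lambda>x. real_of_int \<lfloor>A - x\<rfloor> - of_int \<lfloor>B - x\<rfloor>) has_integral (A - 1) - (B - 1)) {0..<1}"
      by (intro has_integral_diff has_integral_unit_floor)
    then have "((\<lambda>x. \<bar>real_of_int \<lfloor>A - x\<rfloor> - of_int \<lfloor>B - x\<rfloor>\<bar>) has_integral (A - 1) - (B - 1)) {0..<1}"
      by (rule has_integral_eq[rotated]) (use that in \<open>auto simp: floor_mono\<close>)
    then show ?thesis by simp
  qed
  show ?thesis using *[of A B] *[of B A] by (cases "B \<le> A") (auto simp: abs_minus_commute)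
qed

section \<open>Angles, chords and unit vectors\<close>

text \<open>The chord is \<open>2 * \<bar>sin (t / 2)\<bar>\<close>, so with
  \<open>y = \<bar>t\<bar> / 2\<close> the claim becomes
  \<open>y \<le> 2 * \<bar>sin y\<bar>\<close>, which the cubic error bound for the sine gives. The
  sharp constant would be \<open>pi / 2\<close>; the value 2 is enough for the final bound.\<close>

lemma abs_le_norm_cis_minus_1:
  assumes "\<bar>t\<bar> \<le> pi"
  shows "\<bar>t\<bar> \<le> 2 * cmod (cis t - 1)"
proof -
  define y where "y = \<bar>t\<bar> / 2"
  \<comment> \<open>The rational 8/5 lies above \<open>pi / 2\<close>, and its square 2.56 is below
    3; this makes the cubic error at most \<open>y / 2\<close>.\<close>
  have y: "0 \<le> y" "y \<le> 8 / 5" using assms pi_approx by (simp_all add: y_def)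
  have "\<bar>sin y - (\<Sum>m<3. sin_coeff m * y ^ m)\<bar> \<le> inverse (fact 3) * \<bar>y\<bar> ^ 3"
    by (rule Maclaurin_sin_bound)
  moreover have "(\<Sum>m<3. sin_coeff m * y ^ m) = y"
    by (simp add: eval_nat_numeral sin_coeff_def)
  ultimately have "\<bar>sin y - y\<bar> \<le> y ^ 3 / 6"
    using y by (simp add: fact_numeral)
  moreover have "y ^ 2 \<le> (8 / 5) ^ 2" using y by (intro power_mono)
  then have "y * y ^ 2 \<le> y * 3" using y by (intro mult_left_mono) (auto simp: power2_eq_square)
  then have "y ^ 3 / 6 \<le> y / 2" by (simp add: power3_eq_cube power2_eq_square)
  ultimately have "y \<le> 2 * \<bar>sin y\<bar>" by linarith
  moreover have "\<bar>sin y\<bar> = \<bar>sin (t / 2)\<bar>" by (cases "t \<ge> 0") (auto simp: y_def)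
  ultimately show ?thesis
    using dist_exp_i_1[of t] by (simp add: y_def cis_conv_exp)
qed

text \<open>With \<open>p\<close>, \<open>q\<close> the norms, the law of cosines splits the squared
  distance into a radial part \<open>(p - q)^2\<close> and an angular part
  \<open>p * q * norm (sgn a - sgn b)^2\<close>. Dropping the radial part and using
  \<open>(min p q)^2 \<le> p * q\<close> gives the bound.\<close>

lemma min_norm_mult_sgn_diff_le:
  fixes a b :: "'a::real_inner"
  shows "min (norm a) (norm b) * norm (sgn a - sgn b) \<le> norm (a - b)"
proof (cases "a = 0 \<or> b = 0")
  case False
  define p q where "p = norm a" and "q = norm b"
  have pq: "p > 0" "q > 0" using False by (auto simp: p_def q_def)
  have sgn: "norm (sgn a) = 1" "norm (sgn b) = 1" using False by (auto simp: norm_sgn)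
  have ab: "a = p *\<^sub>R sgn a" "b = q *\<^sub>R sgn b" using False by (auto simp: p_def q_def sgn_div_norm)
  have s: "(norm (sgn a - sgn b))\<^sup>2 = 2 - 2 * (sgn a \<bullet> sgn b)"
    using dot_norm_neg[of "sgn a" "sgn b"] sgn by simp
  have "(norm (a - b))\<^sup>2 = p\<^sup>2 + q\<^sup>2 - 2 * (a \<bullet> b)"
    by (simp add: p_def q_def power2_norm_eq_inner inner_diff inner_commute)
  also have "a \<bullet> b = p * q * (sgn a \<bullet> sgn b)"
    by (subst ab(1), subst ab(2)) simp
  finally have "(norm (a - b))\<^sup>2 = (p - q)\<^sup>2 + p * q * (norm (sgn a - sgn b))\<^sup>2"
    unfolding s by (simp add: power2_eq_square algebra_simps)
  moreover have "(min p q)\<^sup>2 \<le> p * q"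
    using pq by (auto simp: power2_eq_square min_def intro: mult_mono)
  then have "(min p q)\<^sup>2 * (norm (sgn a - sgn b))\<^sup>2 \<le> p * q * (norm (sgn a - sgn b))\<^sup>2"
    by (intro mult_right_mono) auto
  ultimately have "(min p q * norm (sgn a - sgn b))\<^sup>2 \<le> (norm (a - b))\<^sup>2"
    using zero_le_power2[of "p - q"] unfolding power_mult_distrib by linarith
  then show ?thesis unfolding p_def q_def by (rule power2_le_imp_le) auto
qed auto

section \<open>Roots of unity and sector indices\<close>

lemma xi_power: "xi k ^ n = cis (2 * pi * real n / real k)"
  by (simp add: xi_def cis_conv_exp mult_ac flip: exp_of_nat_mult)

lemma xi_powi: "xi k powi n = cis (2 * pi * real_of_int n / real k)"
proof -
  have "xi k = cis (2 * pi / real k)" using xi_power[of k 1] by simp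
  then show ?thesis by (simp add: cis_power_int mult_ac)
qed

lemma norm_cis_diff_le: "cmod (cis x - cis y) \<le> \<bar>x - y\<bar>"
proof -
  have "cis x - cis y = cis y * (cis (x - y) - 1)"
    by (simp add: cis_mult algebra_simps)
  then have "cmod (cis x - cis y) = cmod (cis (x - y) - 1)" by (simp add: norm_mult)
  also have "\<dots> \<le> \<bar>x - y\<bar>"
    using dist_exp_i_1[of "x - y"] abs_sin_x_le_abs_x[of "(x - y) / 2"] by (simp add: cis_conv_exp)
  finally show ?thesis .
qed

text \<open>The index \<open>j\<close> of the sector is read off modulo \<open>k\<close> from an arbitrary argument of \<open>z\<close>.\<close>

lemma sector_index:
  assumes k: "k \<ge> 1" and z: "z \<in> sector k (2 * pi * x / real k) j"
    and A: "sgn z = cis (2 * pi * A / real k)"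
  shows "xi k ^ j = xi k powi \<lfloor>A - x\<rfloor>"
proof -
  from z obtain r \<alpha> where r: "r > 0" and z: "z = complex_of_real r * cis \<alpha>"
    and \<alpha>: "2 * pi * x / real k + 2 * pi * real j / real k \<le> \<alpha>"
      "\<alpha> < 2 * pi * x / real k + 2 * pi * (real j + 1) / real k"
    unfolding sector_def by (auto simp: cis_conv_exp)
  have "sgn z = cis \<alpha>" using r by (simp add: z sgn_mult sgn_of_real)
  then have "sin \<alpha> = sin (2 * pi * A / real k) \<and> cos \<alpha> = cos (2 * pi * A / real k)"
    using A by (auto simp: complex_eq_iff)
  then obtain n :: int where n: "\<alpha> = 2 * pi * A / real k + 2 * pi * n"
    using sin_cos_eq_iff by blast
  \<comment> \<open>Angles are now measured in units of one sector width; \<open>n\<close> counts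
    the full turns between the two arguments of \<open>z\<close>, each worth \<open>k\<close>
    sectors.\<close>
  have *: "\<alpha> = 2 * pi / real k * (A + k * n)" using k by (simp add: n field_simps)
  have c: "2 * pi / real k > 0" using k by simp
  have "2 * pi / real k * (x + j) \<le> 2 * pi / real k * (A + k * n)"
    "2 * pi / real k * (A + k * n) < 2 * pi / real k * (x + j + 1)"
    using \<alpha> * by (simp_all add: algebra_simps add_divide_distrib)
  then have "x + j \<le> A + k * n" "A + k * n < x + j + 1"
    using c by (simp_all only: mult_le_cancel_left_pos mult_less_cancel_left_pos)
  then have "\<lfloor>A - x\<rfloor> = int j - int k * n"
    by (simp add: floor_eq_iff)
  then have "real_of_int \<lfloor>A - x\<rfloor> = real j - real k * n"
    by simp
  then have "2 * pi * \<lfloor>A - x\<rfloor> / real k = 2 * pi * real j / real k - 2 * pi * n"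
    using k by (simp only:) (simp add: field_simps)
  then have "xi k powi \<lfloor>A - x\<rfloor> = cis (2 * pi * real j / real k - 2 * pi * n)"
    by (simp only: xi_powi)
  also have "\<dots> = cis (2 * pi * real j / real k)"
    by (simp flip: cis_divide)
  finally show ?thesis by (simp add: xi_power)
qed

text \<open>Averaging over the rotation angle replaces the quantized phases of \<open>a\<close> and \<open>\<sigma> b\<close> by at most
  their angle.\<close>

lemma sector_phase_average:
  assumes k: "k \<ge> 1" and \<sigma>: "\<sigma> \<in> cyclic_group k"
  shows "\<exists>h c. (h has_integral c) {0..<1}
    \<and> min ((cmod a)\<^sup>2) ((cmod b)\<^sup>2) * c \<le> cmod (a - \<sigma> * b) * (cmod a + cmod b)
    \<and> (\<forall>x\<in>{0..<1}. \<forall>i j. a \<in> sector k (2 * pi * x / real k) i \<longrightarrow> b \<in> sector k (2 * pi * x / real k) j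
        \<longrightarrow> cmod (xi k ^ i - \<sigma> * xi k ^ j) \<le> h x)"
proof (cases "a = 0 \<or> b = 0")
  case True
  \<comment> \<open>Zero lies in no sector and the minimum of the squared norms vanishes, so the
    zero function serves as majorant.\<close>
  have "0 \<notin> sector k \<theta> j" for \<theta> j by (auto simp: sector_def)
  then show ?thesis using True
    by (intro exI[of _ "\<lambda>_. 0"] exI[of _ 0]) auto
next
  case False
  from \<sigma> obtain m where m: "\<sigma> = xi k ^ m" by (auto simp: cyclic_group_def)
  have \<sigma>1: "cmod \<sigma> = 1" using norm_cyclic_group[OF \<sigma>] .
  have sgn\<sigma>: "sgn \<sigma> = \<sigma>" using \<sigma>1 by (simp add: sgn_div_norm)
  have nz: "\<sigma> * b \<noteq> 0" using False \<sigma>1 by auto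
  have kr: "real k > 0" using k by simp
  define \<delta> where "\<delta> = Arg (a / (\<sigma> * b))"
  \<comment> \<open>\<open>A\<close> and \<open>B\<close> are arguments of \<open>a\<close> and
    \<open>b\<close> in sector widths. \<open>A\<close> is built from \<open>B\<close> rather than
    from \<open>Arg a\<close>, so that its distance to \<open>B + m\<close>, the position of
    \<open>\<sigma> * b\<close>, is exactly the principal angle \<delta>, without stray full
    turns.\<close>
  define B where "B = k * Arg b / (2 * pi)"
  define A where "A = B + m + k * \<delta> / (2 * pi)"
  have cis\<delta>: "cis \<delta> = sgn a / (\<sigma> * sgn b)"
    using False nz sgn\<sigma> by (simp add: \<delta>_def cis_Arg sgn_divide sgn_mult)
  have cisB: "sgn b = cis (2 * pi * B / real k)"
    using False kr by (simp add: B_def cis_Arg)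
  have "2 * pi * A / real k = 2 * pi * B / real k + 2 * pi * m / real k + \<delta>"
    using kr by (simp add: A_def field_simps)
  then have "cis (2 * pi * A / real k) = sgn b * \<sigma> * cis \<delta>"
    by (simp add: cisB m xi_power flip: cis_mult)
  then have cisA: "sgn a = cis (2 * pi * A / real k)"
    using False nz by (simp add: cis\<delta> sgn_zero_iff)
  \<comment> \<open>\<open>h x\<close> is the arc between the two rounded positions. Rounding
    commutes with the integer shift \<open>m\<close>, so \<sigma> acts exactly on quantized
    phases.\<close>
  define h where "h x = 2 * pi / real k * \<bar>real_of_int \<lfloor>A - x\<rfloor> - of_int \<lfloor>B + m - x\<rfloor>\<bar>" for x
  have "(h has_integral 2 * pi / real k * \<bar>A - (B + m)\<bar>) {0..<1}"
    unfolding h_def by (intro has_integral_mult_right has_integral_unit_floor_diff)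
  moreover have "2 * pi / real k * \<bar>A - (B + m)\<bar> = \<bar>\<delta>\<bar>"
    using kr by (simp add: A_def abs_mult)
  ultimately have int: "(h has_integral \<bar>\<delta>\<bar>) {0..<1}" by simp
  have "\<bar>\<delta>\<bar> \<le> pi" using Arg_bounded[of "a / (\<sigma> * b)"] by (auto simp: \<delta>_def)
  then have "\<bar>\<delta>\<bar> \<le> 2 * cmod (cis \<delta> - 1)" by (rule abs_le_norm_cis_minus_1)
  also have "cmod (cis \<delta> - 1) = cmod (sgn (\<sigma> * b)) * cmod (cis \<delta> - 1)"
    using nz by (simp add: norm_sgn)
  also have "\<dots> = cmod (sgn a - sgn (\<sigma> * b))"
    unfolding norm_mult[symmetric] using False nz by (simp add: cis\<delta> sgn_mult sgn\<sigma> algebra_simps sgn_zero_iff)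
  finally have \<delta>le: "\<bar>\<delta>\<bar> \<le> 2 * cmod (sgn a - sgn (\<sigma> * b))" .
  \<comment> \<open>The squared minimum supplies two factors \<rho>: one turns the distance of the
    unit vectors into \<open>cmod (a - \<sigma> * b)\<close>, the other gives
    \<open>2 * \<rho> \<le> cmod a + cmod b\<close>.\<close>
  define \<rho> where "\<rho> = min (cmod a) (cmod b)"
  have "min ((cmod a)\<^sup>2) ((cmod b)\<^sup>2) = \<rho> * \<rho>"
    unfolding \<rho>_def power2_eq_square[symmetric] by (simp add: min_def power2_le_iff_abs_le)
  then have "min ((cmod a)\<^sup>2) ((cmod b)\<^sup>2) * \<bar>\<delta>\<bar> \<le> \<rho> * \<rho> * (2 * cmod (sgn a - sgn (\<sigma> * b)))"
    using \<delta>le by (simp add: mult_left_mono)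
  also have "\<dots> = 2 * \<rho> * (min (cmod a) (cmod (\<sigma> * b)) * cmod (sgn a - sgn (\<sigma> * b)))"
    using \<sigma>1 by (simp add: \<rho>_def norm_mult)
  also have "\<dots> \<le> 2 * \<rho> * cmod (a - \<sigma> * b)"
    by (intro mult_left_mono min_norm_mult_sgn_diff_le) (simp add: \<rho>_def)
  also have "\<dots> \<le> cmod (a - \<sigma> * b) * (cmod a + cmod b)"
    by (subst mult.commute, intro mult_left_mono) (auto simp: \<rho>_def)
  finally have le: "min ((cmod a)\<^sup>2) ((cmod b)\<^sup>2) * \<bar>\<delta>\<bar> \<le> cmod (a - \<sigma> * b) * (cmod a + cmod b)" .
  have "cmod (xi k ^ i - \<sigma> * xi k ^ j) \<le> h x"
    if "a \<in> sector k (2 * pi * x / real k) i" "b \<in> sector k (2 * pi * x / real k) j" for x i j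
  proof -
    have i: "xi k ^ i = cis (2 * pi * \<lfloor>A - x\<rfloor> / real k)"
      using sector_index[OF k that(1) cisA] by (simp add: xi_powi)
    have "B + m - x = (B - x) + of_int (int m)" by simp
    then have m': "\<lfloor>B + m - x\<rfloor> = m + \<lfloor>B - x\<rfloor>"
      by (simp only: floor_add_int[symmetric] add.commute)
    have "\<sigma> * xi k ^ j = cis (2 * pi * m / real k) * cis (2 * pi * \<lfloor>B - x\<rfloor> / real k)"
      using sector_index[OF k that(2) cisB] by (simp add: m xi_power xi_powi)
    also have "\<dots> = cis (2 * pi * (m + \<lfloor>B - x\<rfloor>) / real k)"
      by (simp add: cis_mult algebra_simps add_divide_distrib)
    also have "\<dots> = cis (2 * pi * \<lfloor>B + m - x\<rfloor> / real k)"
      by (simp add: m')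
    finally have "cmod (xi k ^ i - \<sigma> * xi k ^ j)
        \<le> \<bar>2 * pi * \<lfloor>A - x\<rfloor> / real k - 2 * pi * \<lfloor>B + m - x\<rfloor> / real k\<bar>"
      using norm_cis_diff_le i by simp
    also have "\<dots> = h x"
      using kr by (simp add: h_def abs_mult flip: diff_divide_distrib right_diff_distrib)
    finally show ?thesis .
  qed
  then show ?thesis using int le by (intro exI[of _ h] exI[of _ "\<bar>\<delta>\<bar>"]) auto
qed

section \<open>Edges between two classes of a partition\<close>

lemma inj_on_xi_power: "inj_on (\<lambda>l. xi k ^ l) {..<k}"
proof (cases "k = 0")
  case False
  then show ?thesis
    using Complex.bij_betw_roots_unity[of k] by (simp add: xi_power bij_betw_def)
qed simp

lemma sum_le_of_at_most_one:
  fixes g :: "'a \<Rightarrow> real"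
  assumes "finite L" and "c \<ge> 0" and le: "\<And>l. l \<in> L \<Longrightarrow> Q l \<Longrightarrow> g l \<le> c"
    and unique: "\<And>l l'. l \<in> L \<Longrightarrow> l' \<in> L \<Longrightarrow> Q l \<Longrightarrow> Q l' \<Longrightarrow> l = l'"
  shows "(\<Sum>l\<in>L. if Q l then g l else 0) \<le> c"
proof (cases "\<exists>l\<in>L. Q l")
  case True
  then obtain l where l: "l \<in> L" "Q l" by blast
  have "(\<Sum>i\<in>L. if Q i then g i else 0) = (\<Sum>i\<in>L. if i = l then g i else 0)"
    by (rule sum.cong) (use l unique in auto)
  also have "\<dots> = g l" using assms(1) l by simp
  finally show ?thesis using le[OF l] by simp
qed (use assms in auto)

text \<open>Injectivity of the powers of \<open>xi k\<close> lets an edge occur for at most one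
  \<open>l\<close>. For that \<open>l\<close>, \<open>s u v * xi k ^ j = xi k ^ (i + l)\<close>, so
  \<open>cmod (1 - xi k ^ l)\<close> equals \<open>cmod (xi k ^ i - s u v * xi k ^ j)\<close>, which
  \<open>h\<close> dominates.\<close>

lemma sum_edges_between_le:
  assumes "finite A" "finite B"
    and w: "\<And>u v. {u, v} \<in> E \<Longrightarrow> w u v \<ge> 0"
    and h: "\<And>u v. u \<in> A \<Longrightarrow> v \<in> B \<Longrightarrow> {u, v} \<in> E \<Longrightarrow> cmod (xi k ^ i - s u v * xi k ^ j) \<le> h u v"
  shows "(\<Sum>l\<in>{1..<k}. cmod (1 - xi k ^ l) * edges_between k E w s (int i - int j + int l) A B)
    \<le> (\<Sum>u\<in>A. \<Sum>v\<in>{v \<in> B. {u, v} \<in> E}. w u v * h u v)"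
proof -
  define Q where "Q u v l \<longleftrightarrow> s u v = xi k powi (int i - int j + int l)" for u v l
  have nz: "xi k \<noteq> 0" by (simp add: xi_def)
  have Q: "s u v * xi k ^ j = xi k ^ i * xi k ^ l" if "Q u v l" for u v l
  proof -
    have "xi k powi (int i - int j + int l) * xi k powi int j = xi k powi (int i + int l)"
      by (subst power_int_add[symmetric]) (use nz in auto)
    also have "\<dots> = xi k powi int i * xi k powi int l"
      by (rule power_int_add) (use nz in auto)
    finally show ?thesis using that by (simp add: Q_def)
  qed
  have "(\<Sum>l\<in>{1..<k}. cmod (1 - xi k ^ l) * edges_between k E w s (int i - int j + int l) A B)
    = (\<Sum>l\<in>{1..<k}. \<Sum>u\<in>A. \<Sum>v\<in>{v \<in> B. {u, v} \<in> E}.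
        if Q u v l then cmod (1 - xi k ^ l) * w u v else 0)"
    unfolding edges_between_def sum_distrib_left Q_def
    using assms(2) by (intro sum.cong sum.mono_neutral_cong_left) auto
  also have "\<dots> = (\<Sum>u\<in>A. \<Sum>v\<in>{v \<in> B. {u, v} \<in> E}. \<Sum>l\<in>{1..<k}.
        if Q u v l then cmod (1 - xi k ^ l) * w u v else 0)"
    by (subst sum.swap) (intro sum.cong refl sum.swap)
  also have "\<dots> \<le> (\<Sum>u\<in>A. \<Sum>v\<in>{v \<in> B. {u, v} \<in> E}. w u v * h u v)"
  proof (intro sum_mono sum_le_of_at_most_one)
    fix u v assume u: "u \<in> A" and v: "v \<in> {v \<in> B. {u, v} \<in> E}"
    have hle: "cmod (xi k ^ i - s u v * xi k ^ j) \<le> h u v" using h u v by blast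
    have "0 \<le> h u v" by (rule order_trans[OF norm_ge_zero hle])
    then show "0 \<le> w u v * h u v" using w v by simp
    {
      fix l assume "Q u v l"
      then have "xi k ^ i - s u v * xi k ^ j = xi k ^ i * (1 - xi k ^ l)"
        using Q by (simp add: algebra_simps)
      then have "cmod (1 - xi k ^ l) \<le> h u v"
        using hle by (simp add: norm_mult xi_power)
      then show "cmod (1 - xi k ^ l) * w u v \<le> w u v * h u v"
        using w v by (subst mult.commute) (auto intro: mult_left_mono)
    next
      fix l l' assume l: "l \<in> {1..<k}" "l' \<in> {1..<k}" and q: "Q u v l" "Q u v l'"
      have "xi k ^ l = xi k ^ l'" using Q[OF q(1)] Q[OF q(2)] nz by simp
      then show "l = l'" using inj_onD[OF inj_on_xi_power, of k l l'] l by simp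
    }
  qed simp
  finally show ?thesis .
qed

text \<open>Factor the difference of squares and apply the reverse triangle inequality, using that
  \<sigma> preserves norms. This controls the boundary contribution of an edge.\<close>

lemma abs_norm_sq_diff_le:
  fixes a b :: complex
  assumes "cmod \<sigma> = 1"
  shows "\<bar>(cmod a)\<^sup>2 - (cmod b)\<^sup>2\<bar> \<le> cmod (a - \<sigma> * b) * (cmod a + cmod b)"
proof -
  have "(cmod a)\<^sup>2 - (cmod b)\<^sup>2 = (cmod a - cmod (\<sigma> * b)) * (cmod a + cmod b)"
    using assms by (simp add: norm_mult power2_eq_square algebra_simps)
  then show ?thesis
    by (simp add: abs_mult mult_right_mono norm_triangle_ineq3)
qed

section \<open>Sums over oriented edges and the numerator\<close>

context weighted_graph
begin

lemma sum_oriented_edges: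
  "(\<Sum>(u, v)\<in>oriented_edges E. g u v) = (\<Sum>u\<in>V. \<Sum>v\<in>{v \<in> V. {u, v} \<in> E}. g u v)"
proof -
  have "oriented_edges E = (SIGMA u:V. {v \<in> V. {u, v} \<in> E})"
    using edge_subset by (fastforce simp: oriented_edges_def)
  then show ?thesis using finite_V by (simp add: sum.Sigma)
qed

lemma sum_oriented_edges_swap:
  "(\<Sum>(u, v)\<in>oriented_edges E. g u v) = (\<Sum>(u, v)\<in>oriented_edges E. g v u)"
  by (rule sum.reindex_bij_witness[of _ prod.swap prod.swap])
    (auto simp: oriented_edges_def insert_commute)

lemma weight_nonneg: "{u, v} \<in> E \<Longrightarrow> w u v \<ge> 0"
  using weight_pos by (simp add: less_imp_le)

text \<open>Moves the dependence on the vertex sets from the index set into indicators, so that sums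
  over random sets can be averaged term by term.\<close>

lemma sum_subsets_oriented_edges:
  assumes "A \<subseteq> V" "B \<subseteq> V"
  shows "(\<Sum>u\<in>A. \<Sum>v\<in>{v \<in> B. {u, v} \<in> E}. g u v)
    = (\<Sum>(u, v)\<in>oriented_edges E. of_bool (u \<in> A) * of_bool (v \<in> B) * (g u v :: real))"
proof -
  have "(\<Sum>v\<in>{v \<in> B. {u, v} \<in> E}. g u v)
      = (\<Sum>v\<in>{v \<in> V. {u, v} \<in> E}. of_bool (u \<in> A) * of_bool (v \<in> B) * g u v)" if "u \<in> A" for u
    using assms that finite_V by (intro sum.mono_neutral_cong_left) auto
  then have "(\<Sum>u\<in>A. \<Sum>v\<in>{v \<in> B. {u, v} \<in> E}. g u v)
      = (\<Sum>u\<in>A. \<Sum>v\<in>{v \<in> V. {u, v} \<in> E}. of_bool (u \<in> A) * of_bool (v \<in> B) * g u v)"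
    by (rule sum.cong[OF refl])
  also have "\<dots> = (\<Sum>u\<in>V. \<Sum>v\<in>{v \<in> V. {u, v} \<in> E}. of_bool (u \<in> A) * of_bool (v \<in> B) * g u v)"
    using assms finite_V by (intro sum.mono_neutral_left) auto
  finally show ?thesis by (simp only: sum_oriented_edges)
qed

text \<open>By disjointness, summing the estimate for two classes over all pairs of classes meets
  each oriented edge inside \<open>A\<close> exactly once. The boundary sum contributes the oriented
  edges leaving \<open>A\<close>.\<close>

lemma partiteness_numerator_le:
  fixes k :: nat and P :: "nat \<Rightarrow> 'a set"
  defines "A \<equiv> \<Union>j<k. P j"
  assumes sub: "\<And>i. i < k \<Longrightarrow> P i \<subseteq> V"
    and disj: "\<And>i j. i < k \<Longrightarrow> j < k \<Longrightarrow> i \<noteq> j \<Longrightarrow> P i \<inter> P j = {}"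
    and h: "\<And>i j u v. i < k \<Longrightarrow> j < k \<Longrightarrow> u \<in> P i \<Longrightarrow> v \<in> P j \<Longrightarrow> {u, v} \<in> E
      \<Longrightarrow> cmod (xi k ^ i - s u v * xi k ^ j) \<le> h u v"
  shows "1 / 2 * (\<Sum>i<k. \<Sum>j<k. \<Sum>l\<in>{1..<k}.
        cmod (1 - xi k ^ l) * edges_between k E w s (int i - int j + int l) (P i) (P j))
      + boundary V E w A
    \<le> (\<Sum>(u, v)\<in>oriented_edges E. w u v *
        (of_bool (u \<in> A) * of_bool (v \<in> A) * h u v / 2 + of_bool (u \<in> A) * of_bool (v \<notin> A)))"
proof -
  have fin: "finite (P i)" if "i < k" for i using sub[OF that] finite_V by (rule finite_subset)
  have A: "A \<subseteq> V" using sub by (auto simp: A_def)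
  have union: "(\<Sum>i<k. \<Sum>u\<in>P i. g u) = (\<Sum>u\<in>A. g u)" for g :: "'a \<Rightarrow> real"
    unfolding A_def by (rule sum.UNION_disjoint[symmetric]) (use fin disj in auto)
  have "(\<Sum>i<k. \<Sum>j<k. \<Sum>l\<in>{1..<k}.
        cmod (1 - xi k ^ l) * edges_between k E w s (int i - int j + int l) (P i) (P j))
    \<le> (\<Sum>i<k. \<Sum>j<k. \<Sum>u\<in>P i. \<Sum>v\<in>{v \<in> P j. {u, v} \<in> E}. w u v * h u v)"
    by (intro sum_mono sum_edges_between_le) (use fin h weight_nonneg in auto)
  also have "\<dots> = (\<Sum>i<k. \<Sum>u\<in>P i. \<Sum>j<k. \<Sum>v\<in>P j. if {u, v} \<in> E then w u v * h u v else 0)"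
    by (intro sum.cong refl, subst sum.swap) (use fin in \<open>auto intro!: sum.cong sum.inter_filter\<close>)
  also have "\<dots> = (\<Sum>u\<in>A. \<Sum>v\<in>A. if {u, v} \<in> E then w u v * h u v else 0)"
    by (simp only: union)
  also have "\<dots> = (\<Sum>u\<in>A. \<Sum>v\<in>{v \<in> A. {u, v} \<in> E}. w u v * h u v)"
    using finite_subset[OF A finite_V] by (intro sum.cong refl sum.inter_filter[symmetric])
  also have "\<dots> = (\<Sum>(u, v)\<in>oriented_edges E. of_bool (u \<in> A) * of_bool (v \<in> A) * (w u v * h u v))"
    by (rule sum_subsets_oriented_edges[OF A A])
  finally have 1: "(\<Sum>i<k. \<Sum>j<k. \<Sum>l\<in>{1..<k}.
        cmod (1 - xi k ^ l) * edges_between k E w s (int i - int j + int l) (P i) (P j)) \<le> \<dots>" .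
  have "boundary V E w A
      = (\<Sum>(u, v)\<in>oriented_edges E. of_bool (u \<in> A) * of_bool (v \<in> V - A) * w u v)"
    unfolding boundary_def by (rule sum_subsets_oriented_edges[OF A]) auto
  also have "\<dots> = (\<Sum>(u, v)\<in>oriented_edges E. of_bool (u \<in> A) * of_bool (v \<notin> A) * w u v)"
    by (intro sum.cong refl) (use edge_subset in \<open>fastforce simp: oriented_edges_def\<close>)
  finally have 2: "boundary V E w A = \<dots>" .
  have "1 / 2 * (\<Sum>i<k. \<Sum>j<k. \<Sum>l\<in>{1..<k}.
        cmod (1 - xi k ^ l) * edges_between k E w s (int i - int j + int l) (P i) (P j))
      + boundary V E w A
    \<le> 1 / 2 * (\<Sum>(u, v)\<in>oriented_edges E. of_bool (u \<in> A) * of_bool (v \<in> A) * (w u v * h u v))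
      + (\<Sum>(u, v)\<in>oriented_edges E. of_bool (u \<in> A) * of_bool (v \<notin> A) * w u v)"
    using 1 2 by simp
  also have "\<dots> = (\<Sum>(u, v)\<in>oriented_edges E. w u v *
        (of_bool (u \<in> A) * of_bool (v \<in> A) * h u v / 2 + of_bool (u \<in> A) * of_bool (v \<notin> A)))"
    unfolding sum_distrib_left sum.distrib[symmetric]
    by (intro sum.cong refl) (auto simp: algebra_simps)
  finally show ?thesis .
qed

text \<open>Cauchy-Schwarz with each weight split into two square roots. The gradient factor gives
  \<open>2 * R * M\<close>, as each edge has two orientations; the other factor gives at most
  \<open>4 * d * M\<close>.\<close>

lemma sum_edge_gradient_le:
  assumes \<mu>: "\<forall>u\<in>V. \<mu> u > 0" and s: "signature k E s" and nz: "\<exists>u\<in>V. f u \<noteq> 0"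
  shows "(\<Sum>(u, v)\<in>oriented_edges E. w u v * (cmod (f u - s u v * f v) * (cmod (f u) + cmod (f v))))
    \<le> 2 * sqrt (2 * max_degree V E w \<mu> * rayleigh V E w \<mu> s f) * (\<Sum>u\<in>V. (cmod (f u))\<^sup>2 * \<mu> u)"
    (is "?S \<le> _")
proof -
  let ?O = "oriented_edges E"
  define M where "M = (\<Sum>u\<in>V. (cmod (f u))\<^sup>2 * \<mu> u)"
  define R where "R = rayleigh V E w \<mu> s f"
  define d where "d = max_degree V E w \<mu>"
  from nz obtain u0 where u0: "u0 \<in> V" "f u0 \<noteq> 0" by blast
  have M: "M > 0" unfolding M_def
    by (rule sum_pos2[OF finite_V u0(1)]) (use \<mu> u0 in \<open>auto intro: less_imp_le\<close>)
  define a where "a = (\<lambda>(u, v). sqrt (w u v) * cmod (f u - s u v * f v))"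
  define b where "b = (\<lambda>(u, v). sqrt (w u v) * (cmod (f u) + cmod (f v)))"
  have S: "?S = (\<Sum>e\<in>?O. a e * b e)"
    by (intro sum.cong refl) (auto simp: a_def b_def oriented_edges_def weight_nonneg)
  have "(\<Sum>e\<in>?O. (a e)\<^sup>2) = (\<Sum>(u, v)\<in>?O. w u v * (cmod (f u - s u v * f v))\<^sup>2)"
    by (intro sum.cong refl) (auto simp: a_def oriented_edges_def weight_nonneg power_mult_distrib)
  also have "\<dots> = 2 * edge_sum E (\<lambda>u v. w u v * (cmod (f u - s u v * f v))\<^sup>2)"
    using rayleigh_term_sym[OF weighted_graph_axioms s] by (subst edge_sum_eq_half) auto
  also have "\<dots> = 2 * R * M"
    using M by (simp add: R_def rayleigh_def M_def)
  finally have a: "(\<Sum>e\<in>?O. (a e)\<^sup>2) = 2 * R * M" .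
  have "(\<Sum>e\<in>?O. (b e)\<^sup>2) \<le> (\<Sum>(u, v)\<in>?O. 2 * (w u v * (cmod (f u))\<^sup>2) + 2 * (w u v * (cmod (f v))\<^sup>2))"
  proof (intro sum_mono)
    fix e assume "e \<in> ?O"
    then obtain u v where e: "e = (u, v)" "{u, v} \<in> E" by (auto simp: oriented_edges_def)
    have "(cmod (f u) + cmod (f v))\<^sup>2 \<le> 2 * (cmod (f u))\<^sup>2 + 2 * (cmod (f v))\<^sup>2"
      using zero_le_power2[of "cmod (f u) - cmod (f v)"] by (simp add: power2_eq_square algebra_simps)
    then have "w u v * (cmod (f u) + cmod (f v))\<^sup>2 \<le> w u v * (2 * (cmod (f u))\<^sup>2 + 2 * (cmod (f v))\<^sup>2)"
      using weight_nonneg[OF e(2)] by (rule mult_left_mono)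
    moreover have "(b e)\<^sup>2 = w u v * (cmod (f u) + cmod (f v))\<^sup>2"
      using weight_nonneg[OF e(2)] by (simp add: e(1) b_def power_mult_distrib)
    ultimately show "(b e)\<^sup>2 \<le> (case e of (u, v) \<Rightarrow> 2 * (w u v * (cmod (f u))\<^sup>2) + 2 * (w u v * (cmod (f v))\<^sup>2))"
      by (simp add: e(1) algebra_simps)
  qed
  also have "\<dots> = 2 * (\<Sum>(u, v)\<in>?O. w u v * (cmod (f u))\<^sup>2) + 2 * (\<Sum>(u, v)\<in>?O. w u v * (cmod (f v))\<^sup>2)"
    unfolding sum_distrib_left sum.distrib[symmetric] by (simp add: case_prod_unfold)
  \<comment> \<open>Reversing all orientations makes both sums equal, and collecting by first
    endpoint produces the degrees.\<close>
  also have "(\<Sum>(u, v)\<in>?O. w u v * (cmod (f v))\<^sup>2) = (\<Sum>(u, v)\<in>?O. w u v * (cmod (f u))\<^sup>2)"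
    by (subst sum_oriented_edges_swap)
      (auto intro!: sum.cong simp: oriented_edges_def weight_sym insert_commute)
  also have "(\<Sum>(u, v)\<in>?O. w u v * (cmod (f u))\<^sup>2) = (\<Sum>u\<in>V. degree V E w u * (cmod (f u))\<^sup>2)"
    by (simp add: sum_oriented_edges degree_def sum_distrib_right)
  also have "\<dots> \<le> (\<Sum>u\<in>V. d * ((cmod (f u))\<^sup>2 * \<mu> u))"
  proof (intro sum_mono)
    fix u assume u: "u \<in> V"
    then have "degree V E w u / \<mu> u \<le> d"
      unfolding d_def max_degree_def using finite_V by (intro Max_ge) auto
    then have "degree V E w u \<le> d * \<mu> u" using \<mu> u by (simp add: pos_divide_le_eq)
    then show "degree V E w u * (cmod (f u))\<^sup>2 \<le> d * ((cmod (f u))\<^sup>2 * \<mu> u)"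
      using mult_right_mono[of _ "d * \<mu> u" "(cmod (f u))\<^sup>2"] by (simp add: mult_ac)
  qed
  finally have b: "(\<Sum>e\<in>?O. (b e)\<^sup>2) \<le> 4 * (d * M)"
    by (simp add: M_def sum_distrib_left)
  have RM: "0 \<le> 2 * R * M" unfolding a[symmetric] by (intro sum_nonneg) auto
  have "(\<Sum>e\<in>?O. a e * b e)\<^sup>2 \<le> (\<Sum>e\<in>?O. (a e)\<^sup>2) * (\<Sum>e\<in>?O. (b e)\<^sup>2)"
    by (rule Cauchy_Schwarz_ineq_sum)
  also have "\<dots> \<le> (2 * R * M) * (4 * (d * M))"
    unfolding a using RM by (intro mult_left_mono b)
  also have "\<dots> = (2 * M)\<^sup>2 * (2 * d * R)" by (simp add: power2_eq_square)
  finally have "?S \<le> sqrt ((2 * M)\<^sup>2 * (2 * d * R))"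
    unfolding S by (rule real_le_rsqrt)
  also have "\<dots> = 2 * sqrt (2 * d * R) * M" 
    using M by (simp only: real_sqrt_mult[of "(2 * M)\<^sup>2"] real_sqrt_abs) simp
  finally show ?thesis by (simp add: M_def R_def d_def)
qed

end

section \<open>Averaging over threshold and rotation\<close>

theorem proposition6p6:
  fixes k :: nat
    and V :: "'a set" and E :: "'a set set" and w :: "'a \<Rightarrow> 'a \<Rightarrow> real"
    and \<mu> :: "'a \<Rightarrow> real" and s :: "'a \<Rightarrow> 'a \<Rightarrow> complex" and f :: "'a \<Rightarrow> complex"
  assumes "k \<ge> 1"
    and "weighted_graph V E w"
    and "\<forall>u\<in>V. \<mu> u > 0"
    and "signature k E s"
    and "\<exists>u\<in>V. f u \<noteq> 0"
    and "Max ((\<lambda>u. cmod (f u)) ` V) = 1"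
  shows "\<exists>t'\<in>{0..1}. \<exists>\<theta>'\<in>{0..<2 * pi}.
    partiteness_ratio k V E w \<mu> s (level_part k V f (sqrt t') \<theta>')
      \<le> 2 * sqrt (2 * max_degree V E w \<mu> * rayleigh V E w \<mu> s f)"
proof -
  interpret weighted_graph V E w by fact
  let ?O = "oriented_edges E"
  define C where "C = 2 * sqrt (2 * max_degree V E w \<mu> * rayleigh V E w \<mu> s f)"
  define p where "p u = (cmod (f u))\<^sup>2" for u
  define K where "K u v = cmod (f u - s u v * f v) * (cmod (f u) + cmod (f v))" for u v
  have f1: "cmod (f u) \<le> 1" if "u \<in> V" for u
    using Max_ge[of "(\<lambda>u. cmod (f u)) ` V" "cmod (f u)"] that assms(6) finite_V by auto
  have p01: "0 \<le> p u" "p u \<le> 1" if "u \<in> V" for u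
    using f1[OF that] by (auto simp: p_def power_le_one)
  have edge: "u \<in> V" "v \<in> V" "s u v \<in> cyclic_group k" if "{u, v} \<in> E" for u v
    using that edge_subset[OF that] assms(4) by (auto simp: signature_def oriented_edges_def)
  have "\<forall>e\<in>?O. \<exists>hc. case e of (u, v) \<Rightarrow> (fst hc has_integral snd hc) {0..<1}
    \<and> min (p u) (p v) * snd hc \<le> K u v
    \<and> (\<forall>x\<in>{0..<1}. \<forall>i j. f u \<in> sector k (2 * pi * x / real k) i
        \<longrightarrow> f v \<in> sector k (2 * pi * x / real k) j \<longrightarrow> cmod (xi k ^ i - s u v * xi k ^ j) \<le> fst hc x)"
    using sector_phase_average[OF assms(1) edge(3)]
    unfolding oriented_edges_def p_def K_def by simp
  from bchoice[OF this] obtain hc where hc: "\<forall>e\<in>?O. case e of (u, v) \<Rightarrow> (fst (hc e) has_integral snd (hc e)) {0..<1}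
    \<and> min (p u) (p v) * snd (hc e) \<le> K u v
    \<and> (\<forall>x\<in>{0..<1}. \<forall>i j. f u \<in> sector k (2 * pi * x / real k) i
        \<longrightarrow> f v \<in> sector k (2 * pi * x / real k) j \<longrightarrow> cmod (xi k ^ i - s u v * xi k ^ j) \<le> fst (hc e) x)"
    by blast
  define h where "h u v = fst (hc (u, v))" for u v
  define c where "c u v = snd (hc (u, v))" for u v
  have hint: "(h u v has_integral c u v) {0..<1}"
    and hmin: "min (p u) (p v) * c u v \<le> K u v"
    and hle: "x \<in> {0..<1} \<Longrightarrow> f u \<in> sector k (2 * pi * x / real k) i
        \<Longrightarrow> f v \<in> sector k (2 * pi * x / real k) j \<Longrightarrow> cmod (xi k ^ i - s u v * xi k ^ j) \<le> h u v x"
    if "{u, v} \<in> E" for u v x i j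
    using bspec[OF hc, of "(u, v)"] that by (auto simp: h_def c_def oriented_edges_def)
  \<comment> \<open>Indicator that \<open>u\<close> is selected at threshold \<open>t\<close>. The
    condition \<open>f u \<noteq> 0\<close> matters at \<open>t = 0\<close>, where zeros of
    \<open>f\<close> pass the threshold but lie in no sector.\<close>
  define q :: "'a \<Rightarrow> real \<Rightarrow> real" where "q u t = of_bool (f u \<noteq> 0 \<and> t \<le> p u)" for u t
  \<comment> \<open>\<open>F\<close> is the numerator bound minus \<open>C\<close> times the volume,
    at threshold \<open>t\<close> and rotation \<open>2 * pi * x / k\<close>. \<open>G\<close> is
    its mean over \<open>x\<close>, which affects only \<open>h\<close>, and \<open>I\<close> is the
    mean of \<open>G\<close> over \<open>t\<close>. It suffices to find one point where
    \<open>F\<close> is nonpositive.\<close>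
  define F where "F t x = (\<Sum>(u, v)\<in>?O. w u v * (q u t * q v t * h u v x / 2 + (q u t - q u t * q v t)))
    - C * (\<Sum>u\<in>V. q u t * \<mu> u)" for t x
  define G where "G t = (\<Sum>(u, v)\<in>?O. w u v * (q u t * q v t * c u v / 2 + (q u t - q u t * q v t)))
    - C * (\<Sum>u\<in>V. q u t * \<mu> u)" for t
  define I where "I = (\<Sum>(u, v)\<in>?O. w u v * (min (p u) (p v) * c u v / 2 + (p u - min (p u) (p v))))
    - C * (\<Sum>u\<in>V. p u * \<mu> u)"
  have fin: "finite ?O"
    by (rule finite_subset[of _ "V \<times> V"]) (use edge_subset finite_V in \<open>auto simp: oriented_edges_def\<close>)
  have F: "(F t has_integral G t) {0..<1}" for t
    unfolding F_def[abs_def] G_def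
    by (intro has_integral_diff has_integral_sum[OF fin] has_integral_unit_const)
      (auto simp: oriented_edges_def
        intro!: has_integral_mult_right has_integral_add has_integral_divide hint has_integral_unit_const)
  have q: "(q u has_integral p u) {0..<1}" if "u \<in> V" for u
  proof (cases "f u = 0")
    case False
    then show ?thesis
      using has_integral_unit_threshold[OF p01[OF that]] by (simp add: q_def[abs_def])
  qed (simp add: q_def[abs_def] p_def)
  \<comment> \<open>Both vertices are selected exactly when the smaller of \<open>p u\<close>,
    \<open>p v\<close> passes the threshold, apart from zeros of \<open>f\<close>, where both sides
    vanish.\<close>
  have qq: "((\<lambda>t. q u t * q v t) has_integral min (p u) (p v)) {0..<1}" if "u \<in> V" "v \<in> V" for u v
  proof -
    have "(\<lambda>t. q u t * q v t) = (if p u \<le> p v then q u else q v) \<or> f u = 0 \<or> f v = 0"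
      by (auto simp: q_def fun_eq_iff)
    moreover have "(\<lambda>t. q u t * q v t) = (\<lambda>t. 0)" "min (p u) (p v) = 0" if "f u = 0 \<or> f v = 0"
      using that by (auto simp: q_def p_def)
    ultimately show ?thesis
      using q[OF \<open>u \<in> V\<close>] q[OF \<open>v \<in> V\<close>] by (cases "f u = 0 \<or> f v = 0") (auto simp: min_def split: if_splits)
  qed
  have G: "(G has_integral I) {0..<1}"
    unfolding G_def[abs_def] I_def
    by (intro has_integral_diff has_integral_sum[OF fin] has_integral_mult_right
          has_integral_sum[OF finite_V])
      (auto simp: oriented_edges_def intro!: has_integral_mult_right has_integral_mult_left
        has_integral_add has_integral_diff has_integral_divide q qq dest: edge)
  have "(\<Sum>(u, v)\<in>?O. w u v * (min (p u) (p v) * c u v / 2 + (p u - min (p u) (p v))))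
      \<le> (\<Sum>(u, v)\<in>?O. w u v * K u v)"
  proof -
    \<comment> \<open>Averaging the boundary term over the two orientations replaces
      \<open>p u - min (p u) (p v)\<close> by half of \<open>\<bar>p u - p v\<bar>\<close>. Phase
      and boundary terms then cost at most half of \<open>K u v\<close> each.\<close>
    have "(\<Sum>(u, v)\<in>?O. w u v * (p u - min (p u) (p v))) = (\<Sum>(u, v)\<in>?O. w u v * (p v - min (p u) (p v)))"
      by (subst sum_oriented_edges_swap)
        (auto intro!: sum.cong simp: oriented_edges_def weight_sym insert_commute min.commute)
    then have "(\<Sum>(u, v)\<in>?O. w u v * (min (p u) (p v) * c u v / 2 + (p u - min (p u) (p v))))
      = (\<Sum>(u, v)\<in>?O. w u v * (min (p u) (p v) * c u v / 2))
        + ((\<Sum>(u, v)\<in>?O. w u v * (p u - min (p u) (p v))) + (\<Sum>(u, v)\<in>?O. w u v * (p v - min (p u) (p v)))) / 2"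
      by (simp add: case_prod_unfold distrib_left sum.distrib)
    also have "\<dots> = (\<Sum>(u, v)\<in>?O. w u v * ((min (p u) (p v) * c u v + \<bar>p u - p v\<bar>) / 2))"
      unfolding sum.distrib[symmetric] sum_divide_distrib
      by (intro sum.cong refl) (auto simp: min_def abs_if field_simps)
    also have "\<dots> \<le> (\<Sum>(u, v)\<in>?O. w u v * K u v)"
    proof (intro sum_mono, clarify)
      fix u v assume "(u, v) \<in> ?O"
      then have uv: "{u, v} \<in> E" by (simp add: oriented_edges_def)
      have "\<bar>p u - p v\<bar> \<le> K u v"
        unfolding p_def K_def by (rule abs_norm_sq_diff_le) (rule norm_cyclic_group[OF edge(3)[OF uv]])
      then have "(min (p u) (p v) * c u v + \<bar>p u - p v\<bar>) / 2 \<le> K u v"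
        using hmin[OF uv] by simp
      then show "w u v * ((min (p u) (p v) * c u v + \<bar>p u - p v\<bar>) / 2) \<le> w u v * K u v"
        using weight_nonneg[OF uv] by (rule mult_left_mono)
    qed
    finally show ?thesis .
  qed
  also have "\<dots> \<le> C * (\<Sum>u\<in>V. p u * \<mu> u)"
    unfolding K_def C_def p_def by (rule sum_edge_gradient_le[OF assms(3-5)])
  finally have "I \<le> 0" by (simp add: I_def)
  \<comment> \<open>The mean value argument is applied first in \<open>t\<close> and then in
    \<open>x\<close>, so iterated one-dimensional integrals suffice.\<close>
  then obtain t where t: "t \<in> {0..<1}" "G t \<le> 0"
    using has_integral_unit_ex_le[OF G] by fastforce
  then obtain x where x: "x \<in> {0..<1}" "F t x \<le> 0"
    using has_integral_unit_ex_le[OF F[of t]] by fastforce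
  define \<theta> where "\<theta> = 2 * pi * x / real k"
  have "x / real k < 1" using x assms(1) by (simp add: divide_less_eq)
  then have "2 * pi * (x / real k) < 2 * pi * 1" by (intro mult_strict_left_mono) auto
  then have \<theta>: "\<theta> \<in> {0..<2 * pi}" using x by (simp add: \<theta>_def)
  define P where "P = level_part k V f (sqrt t) \<theta>"
  define A where "A = (\<Union>j<k. P j)"
  \<comment> \<open>A vertex with \<open>cmod (f u) = 1\<close> passes the threshold, so
    \<open>A\<close> is nonempty; this later makes its volume positive.\<close>
  have part: "ordered_partition k A P"
    unfolding A_def P_def using assms(1,5,6) finite_V t by (intro level_part_ordered_partition) auto
  have sqrt_le: "sqrt t \<le> cmod (f u) \<longleftrightarrow> t \<le> p u" for u
    unfolding p_def using t by (metis atLeastLessThan_iff norm_ge_zero real_sqrt_le_iff real_sqrt_unique)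
  have "0 \<notin> sector k \<theta> j" for j by (auto simp: sector_def)
  \<comment> \<open>The sectors cover the punctured unit disc, so the selected set does not depend
    on the rotation.\<close>
  then have "u \<in> A \<longleftrightarrow> f u \<noteq> 0 \<and> t \<le> p u" if "u \<in> V" for u
    using sector_cover[OF assms(1), of "f u" \<theta>] f1[OF that] that
    by (auto simp: A_def P_def level_part_def sqrt_le)
  then have qA: "q u t = of_bool (u \<in> A)" if "u \<in> V" for u
    using that by (simp add: q_def)
  have AV: "A \<subseteq> V" by (auto simp: A_def P_def level_part_def)
  have "(\<Sum>u\<in>V. q u t * \<mu> u) = vol \<mu> A"
    unfolding vol_def using AV finite_V by (intro sum.mono_neutral_cong_right) (auto simp: qA)
  moreover have "1 / 2 * (\<Sum>i<k. \<Sum>j<k. \<Sum>l\<in>{1..<k}.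
        cmod (1 - xi k ^ l) * edges_between k E w s (int i - int j + int l) (P i) (P j))
      + boundary V E w A
    \<le> (\<Sum>(u, v)\<in>?O. w u v *
        (of_bool (u \<in> A) * of_bool (v \<in> A) * h u v x / 2 + of_bool (u \<in> A) * of_bool (v \<notin> A)))"
    unfolding A_def
  proof (rule partiteness_numerator_le)
    show "P i \<inter> P j = {}" if "i < k" "j < k" "i \<noteq> j" for i j
      using part that by (auto simp: ordered_partition_def)
    show "cmod (xi k ^ i - s u v * xi k ^ j) \<le> h u v x"
      if "u \<in> P i" "v \<in> P j" "{u, v} \<in> E" for i j u v
      using that x(1) by (intro hle) (auto simp: P_def level_part_def \<theta>_def)
  qed (auto simp: P_def level_part_def)
  moreover have "\<dots> = (\<Sum>(u, v)\<in>?O. w u v * (q u t * q v t * h u v x / 2 + (q u t - q u t * q v t)))"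
    by (intro sum.cong refl) (auto simp: oriented_edges_def qA edge)
  ultimately have num: "1 / 2 * (\<Sum>i<k. \<Sum>j<k. \<Sum>l\<in>{1..<k}.
        cmod (1 - xi k ^ l) * edges_between k E w s (int i - int j + int l) (P i) (P j))
      + boundary V E w A \<le> C * vol \<mu> A"
    using x(2) by (simp add: F_def)
  have "vol \<mu> A > 0"
    unfolding vol_def using part AV assms(3) finite_subset[OF AV finite_V]
    by (intro sum_pos) (auto simp: ordered_partition_def)
  then have "partiteness_ratio k V E w \<mu> s P \<le> C"
    using num unfolding partiteness_ratio_def A_def[symmetric] by (simp add: pos_divide_le_eq)
  then show ?thesis
    unfolding C_def P_def using t(1) \<theta> by (intro bexI[of _ t] bexI[of _ \<theta>]) auto
qed

end
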